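(* Let $\mathcal{V}$ be a type $r$ family of pseudolines in $\mathbb{R}^n$, and let $P\subset\mathbb{R}^n$ be a homogeneous set of $N$ points with enclosing cube $Q$ (the rectifiability of $\mathcal{V}$ being with respect to $Q$). Let $k$ be a positive integer. Then: (i) if $k\ge C N^{1/n}$ for large enough $C$, then there are no $k$-rich pseudolines in $\mathcal{V}$; (ii) if $k\le C N^{1/n}$, then the number of $k$-rich pseudolines in $\mathcal{V}$ is bounded by $$O\left(\frac{N^r}{k^{n(r-1)+1}}\right).$$ All constants depend only on $n$ and $r$.
   Context: Here $n$ and $r$ are positive integers, and all constants, including those implied in the definitions below, depend only on $n$ and $r$. Homogeneous set: a finite point set $P\subset\mathbb{R}^n$ is homogeneous if $P$ lies in the interior of an $n$-dimensional cube $Q=[0,a]^n$ (the enclosing cube) of volume $\Theta(|P|)$, and any unit cube in $\mathbb{R}^n$ contains at most $O(1)$ points of $P$. Rich: a set $S\subset\mathbb{R}^n$ is $m$-rich if it contains at least $m$ points of $P$. Pseudolines: a family $\mathcal{V}$ of subsets of $\mathbb{R}^n$ is a type $r$ family of pseudolines if both of the following hold. (i) (rectifiability) For every $t\in\mathbb{N}$, if the enclosing cube $Q$ is subdivided into $t^n$ congruent subcubes, disjoint except for boundary, then each $V\in\mathcal{V}$ has nonempty intersection with at most $O(t)$ of the subcubes. (ii) (type $r$) For any $r$ distinct points in $\mathbb{R}^n$, there is at most one $V\in\mathcal{V}$ which contains them all.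
   Formalization: Part (ii) is stated for k at least r: for k < r it fails, since infinitely many pseudolines of a type r family can share the same k points of P (e.g. all lines through one point when r = 2, k = 1). *)

theory Defs
  imports "HOL-Analysis.Analysis"
begin

text \<open>
  The implied constants of the asymptotic notation are explicit parameters throughout:
  \<open>c1\<close>, \<open>c2\<close> for the volume of the enclosing cube, \<open>B\<close> for the number of points in a unit
  cube, \<open>A\<close> for rectifiability.
\<close>

definition cube :: "real \<Rightarrow> (real ^ 'n) set" where
  "cube a = cbox 0 (\<chi> i. a)"

text \<open>Unit cubes may have any position and any orientation.\<close>

definition unit_cube :: "(real ^ 'n) set \<Rightarrow> bool" where
  "unit_cube U \<longleftrightarrow>
     (\<exists>(f :: real ^ 'n \<Rightarrow> real ^ 'n) x. orthogonal_transformation f \<and> U = (\<lambda>y. x + f y) ` cube 1)"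

definition homogeneous ::
  "real \<Rightarrow> real \<Rightarrow> real \<Rightarrow> real \<Rightarrow> (real ^ 'n) set \<Rightarrow> bool" where
  "homogeneous c1 c2 B a P \<longleftrightarrow>
     finite P \<and> a > 0 \<and> P \<subseteq> interior (cube a) \<and>
     c1 * real (card P) \<le> measure lebesgue (cube a :: (real ^ 'n) set) \<and>
     measure lebesgue (cube a :: (real ^ 'n) set) \<le> c2 * real (card P) \<and>
     (\<forall>U. unit_cube U \<longrightarrow> real (card (P \<inter> U)) \<le> B)"

definition rich :: "(real ^ 'n) set \<Rightarrow> nat \<Rightarrow> (real ^ 'n) set \<Rightarrow> bool" where
  "rich P m S \<longleftrightarrow> m \<le> card (P \<inter> S)"

definition subcubes :: "real \<Rightarrow> nat \<Rightarrow> (real ^ 'n) set set" where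
  "subcubes a t =
     {cbox (\<chi> i. a * real (j i) / real t) (\<chi> i. a * real (j i + 1) / real t) | j :: 'n \<Rightarrow> nat.
        \<forall>i. j i < t}"

definition rectifiable :: "real \<Rightarrow> real \<Rightarrow> (real ^ 'n) set set \<Rightarrow> bool" where
  "rectifiable A a \<V> \<longleftrightarrow>
     (\<forall>t\<ge>1. \<forall>V\<in>\<V>. real (card {S \<in> subcubes a t. V \<inter> S \<noteq> {}}) \<le> A * real t)"

definition of_type :: "nat \<Rightarrow> (real ^ 'n) set set \<Rightarrow> bool" where
  "of_type r \<V> \<longleftrightarrow>
     (\<forall>X. finite X \<and> card X = r \<longrightarrow> (\<exists>\<^sub>\<le>\<^sub>1 V. V \<in> \<V> \<and> X \<subseteq> V))"

definition pseudolines :: "real \<Rightarrow> real \<Rightarrow> nat \<Rightarrow> (real ^ 'n) set set \<Rightarrow> bool" where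
  "pseudolines A a r \<V> \<longleftrightarrow> rectifiable A a \<V> \<and> of_type r \<V>"

text \<open>
  A bound on the number of \<open>k\<close>-rich members of a type \<open>r\<close> family can hold only for \<open>k \<ge> r\<close>:
  arbitrarily many members may share the same \<open>r - 1\<close> points (for instance, the lines through
  one point when \<open>r = 2\<close>).
\<close>

end

theory Submission
  imports Defs
begin

text \<open>
  Subdivide the enclosing cube into \<open>t ^ n\<close> subcubes and count the \<open>r\<close>-subsets of \<open>P\<close> that lie in
  a single subcube. A pseudoline meets at most \<open>A * t\<close> subcubes, so for \<open>t\<close> about
  \<open>k / (2 * r * A)\<close> the points on a \<open>k\<close>-rich one share subcubes so often that it contains at least
  \<open>k / 2\<close> such subsets; each subset lies on at most one pseudoline. Homogeneity bounds
  the number of subsets by \<open>O(t ^ n * (a / t) ^ (n * r))\<close>, which is \<open>O(N ^ r / k ^ (n * (r - 1)))\<close>.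
  Part (i) is the case of subcubes of side at most 1, which contain \<open>O(1)\<close> points each.
\<close>

section \<open>Counting \<open>r\<close>-subsets in cells and double counting\<close>

lemma binomial_ge_diff:
  assumes "r \<ge> 1"
  shows "m + 1 \<le> (m choose r) + r"
  using assms
proof (induction m arbitrary: r)
  case (Suc m)
  then obtain q where q: "r = Suc q" by (cases r) auto
  show ?case
  proof (cases "q \<le> m")
    case True
    then have "(m choose q) \<ge> 1" by (simp add: Suc_leI)
    \<comment> \<open>By Pascal's rule, passing from \<open>m\<close> to \<open>Suc m\<close> adds
      \<open>m choose q\<close>, which is at least 1 here. In the other case \<open>r\<close> alone
      already exceeds \<open>Suc m\<close>.\<close>
    with Suc.IH[of r] Suc.prems q show ?thesis by simp
  qed (use q in simp)
qed simp

lemma binomial_le_power: "m choose r \<le> m ^ r"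
  by (cases "r \<le> m") (simp_all add: binomial_le_pow binomial_eq_0)

text \<open>A cell with \<open>m\<close> points of \<open>T\<close> contains at least
  \<open>m - (r - 1)\<close> of the \<open>r\<close>-subsets, so each cell costs at most
  \<open>r - 1\<close> points. Cells may overlap, as closed subcubes do along faces; the induction
  therefore assigns \<open>T \<inter> S\<close> to the cell \<open>S\<close> and leaves only
  \<open>T - S\<close> to the others, so that no subset is counted twice.\<close>

lemma card_subsets_in_cells:
  assumes "r \<ge> 1" and "finite \<S>" and "finite T" and "T \<subseteq> \<Union>\<S>"
  shows "card T \<le> card {X. X \<subseteq> T \<and> card X = r \<and> (\<exists>S\<in>\<S>. X \<subseteq> S)} + (r - 1) * card \<S>"
  using assms(2-4)
proof (induction \<S> arbitrary: T rule: finite_induct)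
  case (insert S \<S>)
  let ?F = "\<lambda>T \<S>. {X. X \<subseteq> T \<and> card X = r \<and> (\<exists>S\<in>\<S>. X \<subseteq> S)}"
  let ?G = "{X. X \<subseteq> T \<inter> S \<and> card X = r}"
  have fin: "finite (?F T' \<S>')" if "finite T'" for T' \<S>'
    by (rule finite_subset[of _ "Pow T'"]) (use that in auto)
  have IH: "card (T - S) \<le> card (?F (T - S) \<S>) + (r - 1) * card \<S>"
    using insert.prems by (intro insert.IH) auto
  have G: "card ?G = (card (T \<inter> S) choose r)"
    using n_subsets[of "T \<inter> S"] insert.prems(1) by simp
  have "?F (T - S) \<S> \<inter> ?G = {}"
  proof (rule ccontr)
    assume "?F (T - S) \<S> \<inter> ?G \<noteq> {}"
    then obtain X where "X \<subseteq> T - S" "X \<subseteq> T \<inter> S" "card X = r" by blast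
    then have "X = {}" by blast
    with \<open>card X = r\<close> assms(1) show False by simp
  qed
  moreover have "finite ?G"
    by (rule finite_subset[of _ "Pow T"]) (use insert.prems in auto)
  ultimately have "card (?F (T - S) \<S>) + card ?G = card (?F (T - S) \<S> \<union> ?G)"
    using fin insert.prems(1) by (subst card_Un_disjoint) auto
  also have "\<dots> \<le> card (?F T (insert S \<S>))"
    by (intro card_mono fin[OF insert.prems(1)]) auto
  finally have "card (?F (T - S) \<S>) + (card (T \<inter> S) choose r) \<le> card (?F T (insert S \<S>))"
    using G by simp
  moreover have "card T = card (T - S) + card (T \<inter> S)"
    using insert.prems(1) by (metis add.commute card_Int_Diff)
  moreover have "card (T \<inter> S) \<le> (card (T \<inter> S) choose r) + (r - 1)"
    using binomial_ge_diff[OF assms(1), of "card (T \<inter> S)"] assms(1) by simp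
  ultimately show ?case
    using IH insert.hyps by simp
qed simp

text \<open>Finiteness of \<open>W\<close> comes from uniqueness as well: choosing for each
  \<open>V\<close> one member of \<open>F\<close> inside it is injective. The sets of members of
  \<open>F\<close> below distinct \<open>V\<close> are then disjoint parts of \<open>F\<close>, each
  of size at least \<open>m\<close>.\<close>

lemma double_count:
  fixes m :: real
  assumes "finite F" and "m > 0"
    and ge: "\<And>V. V \<in> W \<Longrightarrow> m \<le> real (card {X \<in> F. X \<subseteq> V})"
    and uniq: "\<And>X V V'. X \<in> F \<Longrightarrow> V \<in> W \<Longrightarrow> V' \<in> W \<Longrightarrow> X \<subseteq> V \<Longrightarrow> X \<subseteq> V' \<Longrightarrow> V = V'"
  shows "finite W" and "real (card W) * m \<le> real (card F)"
proof -
  have "\<exists>X. X \<in> F \<and> X \<subseteq> V" if "V \<in> W" for V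
  proof (rule ccontr)
    assume "\<not> ?thesis"
    then have "{X \<in> F. X \<subseteq> V} = {}" by blast
    with ge[OF that] assms(2) show False by (metis card.empty not_le of_nat_0)
  qed
  then obtain f where f: "\<And>V. V \<in> W \<Longrightarrow> f V \<in> F \<and> f V \<subseteq> V" by metis
  have "inj_on f W"
    by (rule inj_onI) (metis f uniq)
  then show fin: "finite W"
    by (rule inj_on_finite[of f _ F]) (use f assms(1) in auto)
  have "real (card W) * m \<le> (\<Sum>V\<in>W. real (card {X \<in> F. X \<subseteq> V}))"
    using sum_bounded_below[of W m "\<lambda>V. real (card {X \<in> F. X \<subseteq> V})"] ge by simp
  also have "\<dots> = real (card (\<Union>V\<in>W. {X \<in> F. X \<subseteq> V}))"
  proof -
    have "\<forall>V\<in>W. \<forall>V'\<in>W. V \<noteq> V' \<longrightarrow> {X \<in> F. X \<subseteq> V} \<inter> {X \<in> F. X \<subseteq> V'} = {}"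
      using uniq by blast
    then show ?thesis using fin assms(1) by (simp add: card_UN_disjoint)
  qed
  also have "\<dots> \<le> real (card F)"
    by (intro of_nat_mono card_mono) (use assms(1) in auto)
  finally show "real (card W) * m \<le> real (card F)" .
qed

section \<open>Cubes, unit cubes and subdivisions\<close>

lemma card_lattice_functions:
  "finite {j :: 'n::finite \<Rightarrow> nat. \<forall>i. j i < t}"
  "card {j :: 'n::finite \<Rightarrow> nat. \<forall>i. j i < t} = t ^ CARD('n)"
proof -
  have eq: "{j :: 'n \<Rightarrow> nat. \<forall>i. j i < t} = PiE UNIV (\<lambda>_. {..<t})"
    by (simp add: PiE_UNIV_domain Pi_def)
  show "finite {j :: 'n::finite \<Rightarrow> nat. \<forall>i. j i < t}"
    unfolding eq by (rule finite_PiE) simp_all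
  show "card {j :: 'n::finite \<Rightarrow> nat. \<forall>i. j i < t} = t ^ CARD('n)"
    unfolding eq by (simp add: card_PiE)
qed

lemma unit_cube_cbox: "unit_cube (cbox u (u + (\<chi> i. 1)) :: (real ^ 'n) set)"
proof -
  have "cbox u (u + (\<chi> i. 1)) = (\<lambda>y. u + y) ` (cube 1 :: (real ^ 'n) set)"
    using cbox_translation[of u 0 "(\<chi> i. 1) :: real ^ 'n"] by (simp only: cube_def add_0_right)
  then show ?thesis
    unfolding unit_cube_def by (intro exI[of _ "\<lambda>y. y"] exI[of _ u] conjI orthogonal_transformation_id)
qed

lemma measure_cube:
  assumes "a \<ge> 0"
  shows "measure lebesgue (cube a :: (real ^ 'n) set) = a ^ CARD('n)"
proof -
  have "(cube a :: (real ^ 'n) set) \<noteq> {}"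
    using assms by (auto simp: cube_def interval_ne_empty_cart)
  then show ?thesis
    by (simp add: cube_def content_cbox_cart)
qed

text \<open>The box is covered by axis-parallel unit cubes at integer offsets from its corner
  \<open>u\<close>, and each of them holds at most \<open>B\<close> points.\<close>

lemma card_cbox_le:
  fixes P :: "(real ^ 'n) set" and u :: "real ^ 'n"
  assumes "finite P" and "s \<ge> 0" and "B \<ge> 0"
    and unit: "\<And>U. unit_cube U \<Longrightarrow> real (card (P \<inter> U)) \<le> B"
  shows "real (card (P \<inter> cbox u (u + (\<chi> i. s)))) \<le> B * (s + 1) ^ CARD('n)"
proof -
  \<comment> \<open>Offsets are found by rounding down, so they range over \<open>0\<close> to the
    floor of \<open>s\<close> inclusive; hence the extra 1, which still keeps
    \<open>t \<le> s + 1\<close>.\<close>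
  define t where "t = nat \<lfloor>s\<rfloor> + 1"
  define J where "J = {j :: 'n \<Rightarrow> nat. \<forall>i. j i < t}"
  define U where "U j = (let v = u + (\<chi> i. real (j i)) in cbox v (v + (\<chi> i. 1)))" for j :: "'n \<Rightarrow> nat"
  have "P \<inter> cbox u (u + (\<chi> i. s)) \<subseteq> (\<Union>j\<in>J. P \<inter> U j)"
  proof
    fix p assume p: "p \<in> P \<inter> cbox u (u + (\<chi> i. s))"
    then have b: "0 \<le> p $ i - u $ i" "p $ i - u $ i \<le> s" for i
      by (auto simp: mem_box_cart algebra_simps)
    define j where "j i = nat \<lfloor>p $ i - u $ i\<rfloor>" for i
    have "j i < t" for i
      using b[of i] floor_mono[OF b(2)[of i]] by (simp add: j_def t_def less_Suc_eq_le nat_mono)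
    moreover have "p \<in> U j"
    proof -
      have "real (j i) \<le> p $ i - u $ i" "p $ i - u $ i \<le> real (j i) + 1" for i
        using b[of i] unfolding j_def by linarith+
      then show ?thesis
        by (auto simp: U_def Let_def mem_box_cart algebra_simps)
    qed
    ultimately show "p \<in> (\<Union>j\<in>J. P \<inter> U j)"
      using p by (auto simp: J_def)
  qed
  then have "card (P \<inter> cbox u (u + (\<chi> i. s))) \<le> card (\<Union>j\<in>J. P \<inter> U j)"
    using assms(1) by (intro card_mono) (auto simp: J_def card_lattice_functions)
  also have "\<dots> \<le> (\<Sum>j\<in>J. card (P \<inter> U j))"
    by (intro card_UN_le) (simp add: J_def card_lattice_functions)
  finally have "real (card (P \<inter> cbox u (u + (\<chi> i. s)))) \<le> (\<Sum>j\<in>J. real (card (P \<inter> U j)))"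
    by (simp flip: of_nat_sum)
  also have "\<dots> \<le> real (card J) * B"
    by (intro sum_bounded_above unit) (simp add: U_def Let_def unit_cube_cbox)
  also have "\<dots> = B * real t ^ CARD('n)"
    by (simp add: J_def card_lattice_functions)
  also have "\<dots> \<le> B * (s + 1) ^ CARD('n)"
    using assms(2,3) by (intro mult_left_mono power_mono) (auto simp: t_def)
  finally show ?thesis .
qed

lemma
  fixes a :: real
  shows finite_subcubes: "finite (subcubes a t :: (real ^ 'n) set set)"
    and card_subcubes: "card (subcubes a t :: (real ^ 'n) set set) \<le> t ^ CARD('n)"
proof -
  have eq: "(subcubes a t :: (real ^ 'n) set set) =
      (\<lambda>j. cbox (\<chi> i. a * real (j i) / real t) (\<chi> i. a * real (j i + 1) / real t))
        ` {j. \<forall>i. j i < t}"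
    by (auto simp: subcubes_def)
  show "finite (subcubes a t :: (real ^ 'n) set set)"
    unfolding eq by (intro finite_imageI card_lattice_functions)
  show "card (subcubes a t :: (real ^ 'n) set set) \<le> t ^ CARD('n)"
    unfolding eq by (rule order_trans[OF card_image_le]) (simp_all add: card_lattice_functions)
qed

lemma card_met_subcubes_le:
  assumes "rectifiable A a \<V>" and "V \<in> \<V>" and "t \<ge> 1"
  shows "real (card {S \<in> subcubes a t. V \<inter> S \<noteq> {}}) \<le> A * real t"
  using assms by (simp add: rectifiable_def)

text \<open>The index of a subcube around \<open>p\<close> is \<open>p $ i * t / a\<close> rounded
  down. Being interior matters: \<open>p $ i < a\<close> keeps the index strictly below
  \<open>t\<close>.\<close>

lemma interior_cube_covered:
  assumes "a > 0" and "t \<ge> 1"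
  shows "interior (cube a :: (real ^ 'n) set) \<subseteq> \<Union> (subcubes a t)"
proof
  fix p :: "real ^ 'n" assume "p \<in> interior (cube a)"
  then have p: "0 < p $ i" "p $ i < a" for i
    by (auto simp: cube_def interior_cbox mem_box_cart)
  define j where "j i = nat \<lfloor>p $ i * t / a\<rfloor>" for i
  have x: "0 \<le> p $ i * t / a" "p $ i * t / a < t" for i
    using p[of i] assms by (auto simp: divide_simps)
  have "j i < t" for i
    using x[of i] unfolding j_def by linarith
  moreover have "a * real (j i) / t \<le> p $ i" "p $ i \<le> a * real (j i + 1) / t" for i
  proof -
    have "real (j i) \<le> p $ i * t / a" "p $ i * t / a \<le> real (j i + 1)"
      using x[of i] unfolding j_def by linarith+
    then show "a * real (j i) / t \<le> p $ i" "p $ i \<le> a * real (j i + 1) / t"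
      using assms by (auto simp: field_simps)
  qed
  ultimately show "p \<in> \<Union> (subcubes a t)"
    unfolding subcubes_def
    by (intro UnionI[where X = "cbox (\<chi> i. a * real (j i) / real t) (\<chi> i. a * real (j i + 1) / real t)"])
      (auto simp: mem_box_cart)
qed

section \<open>Estimates for a fixed homogeneous set\<close>

context
  fixes c1 c2 B a :: real and P :: "(real ^ 'n) set"
  assumes hom: "homogeneous c1 c2 B a P" and pos: "c1 > 0" "c2 > 0" "B > 0"
begin

lemma homogeneous_finite: "finite P" and homogeneous_side_pos: "a > 0"
  using hom by (auto simp: homogeneous_def)

lemma homogeneous_card_pos: "card P > 0"
proof -
  have "0 < a ^ CARD('n)" using homogeneous_side_pos by simp
  also have "\<dots> \<le> c2 * real (card P)"
    using hom homogeneous_side_pos by (simp add: homogeneous_def measure_cube)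
  finally show ?thesis using pos by (simp add: zero_less_mult_iff)
qed

text \<open>These are the \<open>n\<close>-th roots of the volume bounds: the side \<open>a\<close>
  is comparable to \<open>\<nu>\<close>, the \<open>n\<close>-th root of the number of points. The
  bound \<open>1 \<le> \<nu>\<close> serves to absorb additive constants.\<close>

lemma homogeneous_side_bounds:
  defines "\<nu> \<equiv> real (card P) powr (1 / real CARD('n))"
  shows "1 \<le> \<nu>" "\<nu> ^ CARD('n) = real (card P)"
    "c1 powr (1 / real CARD('n)) * \<nu> \<le> a" "a \<le> c2 powr (1 / real CARD('n)) * \<nu>"
proof -
  have root: "(x ^ CARD('n)) powr (1 / real CARD('n)) = x" if "x > 0" for x :: real
    using that by (simp add: powr_powr flip: powr_realpow)
  show "1 \<le> \<nu>"
    using homogeneous_card_pos by (simp add: \<nu>_def ge_one_powr_ge_zero Suc_leI)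
  show "\<nu> ^ CARD('n) = real (card P)"
    using homogeneous_card_pos by (simp add: \<nu>_def powr_power)
  have *: "c1 * real (card P) \<le> a ^ CARD('n)" "a ^ CARD('n) \<le> c2 * real (card P)"
    using hom homogeneous_side_pos by (simp_all add: homogeneous_def measure_cube)
  show "c1 powr (1 / real CARD('n)) * \<nu> \<le> a"
    using powr_mono2[OF _ _ *(1), of "1 / real CARD('n)"] pos homogeneous_side_pos
    by (simp add: \<nu>_def powr_mult root)
  show "a \<le> c2 powr (1 / real CARD('n)) * \<nu>"
    using powr_mono2[OF _ _ *(2), of "1 / real CARD('n)"] pos homogeneous_side_pos
    by (simp add: \<nu>_def powr_mult root)
qed

lemma card_subcube_le:
  assumes "S \<in> subcubes a t" and "t \<ge> 1"
  shows "real (card (P \<inter> S)) \<le> B * (a / t + 1) ^ CARD('n)"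
proof -
  obtain j where "S = cbox (\<chi> i. a * real (j i) / real t) (\<chi> i. a * real (j i + 1) / real t)"
    using assms by (auto simp: subcubes_def)
  moreover have "(\<chi> i. a * real (j i + 1) / real t) = (\<chi> i. a * real (j i) / real t) + (\<chi> i. a / t)"
    by (simp add: vec_eq_iff add_divide_distrib algebra_simps)
  ultimately show ?thesis
    using card_cbox_le[of P "a / t" B] hom pos homogeneous_side_pos by (auto simp: homogeneous_def)
qed

lemma covered_by_met_subcubes:
  assumes "t \<ge> 1"
  shows "P \<inter> V \<subseteq> \<Union> {S \<in> subcubes a t. V \<inter> S \<noteq> {}}"
proof
  fix p assume p: "p \<in> P \<inter> V"
  then have "p \<in> \<Union> (subcubes a t)"
    using interior_cube_covered[OF homogeneous_side_pos assms] hom unfolding homogeneous_def by blast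
  with p show "p \<in> \<Union> {S \<in> subcubes a t. V \<inter> S \<noteq> {}}" by blast
qed

text \<open>Rounding \<open>a\<close> up to \<open>t\<close> gives subcubes of side at most 1, each
  with at most \<open>B * 2 ^ CARD('n)\<close> points. A pseudoline meets at most
  \<open>A * t\<close> of them, which yields part (i).\<close>

lemma card_pseudoline_le:
  assumes "rectifiable A a \<V>" and "A > 0" and "V \<in> \<V>"
  shows "real (card (P \<inter> V)) \<le>
    A * B * 2 ^ CARD('n) * (c2 powr (1 / real CARD('n)) + 1) * real (card P) powr (1 / real CARD('n))"
proof -
  define t where "t = nat \<lceil>a\<rceil>"
  let ?\<S> = "{S \<in> subcubes a t. V \<inter> S \<noteq> {}}"
  have t: "t \<ge> 1" "a \<le> t" "t \<le> a + 1"
    using homogeneous_side_pos unfolding t_def by linarith+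
  have fin: "finite ?\<S>" by (rule finite_subset[OF _ finite_subcubes]) auto
  have "P \<inter> V \<subseteq> (\<Union>S\<in>?\<S>. P \<inter> S)"
    using covered_by_met_subcubes[OF t(1), of V] by blast
  then have "card (P \<inter> V) \<le> card (\<Union>S\<in>?\<S>. P \<inter> S)"
    using fin homogeneous_finite by (intro card_mono) auto
  also have "\<dots> \<le> (\<Sum>S\<in>?\<S>. card (P \<inter> S))"
    by (intro card_UN_le fin)
  finally have "real (card (P \<inter> V)) \<le> (\<Sum>S\<in>?\<S>. real (card (P \<inter> S)))"
    by (simp flip: of_nat_sum)
  also have "\<dots> \<le> real (card ?\<S>) * (B * 2 ^ CARD('n))"
  proof (rule sum_bounded_above)
    fix S assume "S \<in> ?\<S>"
    then have "real (card (P \<inter> S)) \<le> B * (a / t + 1) ^ CARD('n)"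
      using card_subcube_le t by blast
    also have "\<dots> \<le> B * 2 ^ CARD('n)"
      using t pos homogeneous_side_pos by (intro mult_left_mono power_mono) auto
    finally show "real (card (P \<inter> S)) \<le> B * 2 ^ CARD('n)" .
  qed
  also have "\<dots> \<le> (A * t) * (B * 2 ^ CARD('n))"
    using card_met_subcubes_le[OF assms(1,3) t(1)] pos by (intro mult_right_mono) auto
  also have "\<dots> \<le> (A * ((c2 powr (1 / real CARD('n)) + 1) * real (card P) powr (1 / real CARD('n))))
      * (B * 2 ^ CARD('n))"
  proof -
    \<comment> \<open>The 1 in \<open>t \<le> a + 1\<close> is absorbed into a multiple of the root
      of \<open>card P\<close>, which is at least 1.\<close>
    have "real t \<le> (c2 powr (1 / real CARD('n)) + 1) * real (card P) powr (1 / real CARD('n))"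
      using homogeneous_side_bounds(1,4) t unfolding distrib_right by linarith
    then show ?thesis using pos assms(2) by (intro mult_right_mono mult_left_mono) auto
  qed
  finally show ?thesis by (simp only: ac_simps)
qed

lemma of_type_uniq:
  assumes "of_type r \<V>" "finite X" "card X = r" "V \<in> \<V>" "V' \<in> \<V>" "X \<subseteq> V" "X \<subseteq> V'"
  shows "V = V'"
proof -
  have "\<exists>\<^sub>\<le>\<^sub>1 V. V \<in> \<V> \<and> X \<subseteq> V"
    using assms(1-3) by (simp add: of_type_def)
  then show ?thesis using assms(4-7) by (auto simp: Uniq_def)
qed

text \<open>Since \<open>k \<ge> r\<close>, every \<open>k\<close>-rich member contains an
  \<open>r\<close>-subset of \<open>P\<close>, and this subset determines it. This crude bound
  covers small \<open>k\<close>, where no subdivision is fine enough to help.\<close>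

lemma card_rich_le_power:
  assumes "of_type r \<V>" and "k \<ge> r"
  shows "finite {V \<in> \<V>. rich P k V}" and "real (card {V \<in> \<V>. rich P k V}) \<le> real (card P) ^ r"
proof -
  let ?F = "{X. X \<subseteq> P \<and> card X = r}"
  let ?W = "{V \<in> \<V>. rich P k V}"
  have fin: "finite ?F"
    by (rule finite_subset[of _ "Pow P"]) (use homogeneous_finite in auto)
  have ge: "1 \<le> real (card {X \<in> ?F. X \<subseteq> V})" if "V \<in> ?W" for V
  proof -
    have "r \<le> card (P \<inter> V)" using that assms(2) by (simp add: rich_def)
    then obtain X where "X \<subseteq> P \<inter> V" "card X = r" by (meson obtain_subset_with_card_n)
    then have "{X \<in> ?F. X \<subseteq> V} \<noteq> {}" by blast
    moreover have "finite {X \<in> ?F. X \<subseteq> V}" by (rule finite_subset[OF _ fin]) blast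
    ultimately have "card {X \<in> ?F. X \<subseteq> V} > 0" by (subst card_gt_0_iff) blast
    then show ?thesis by linarith
  qed
  have uniq: "V = V'"
    if "X \<in> ?F" "V \<in> ?W" "V' \<in> ?W" "X \<subseteq> V" "X \<subseteq> V'" for X V V'
    using of_type_uniq[OF assms(1), of X V V'] that finite_subset[OF _ homogeneous_finite] by blast
  note dc = double_count[OF fin zero_less_one ge uniq, of ?W]
  show "finite ?W" by (rule dc(1)) auto
  have "real (card ?W) \<le> real (card ?F)"
    using dc(2) by simp
  also have "card ?F = (card P choose r)"
    by (rule n_subsets[OF homogeneous_finite])
  also have "real \<dots> \<le> real (card P) ^ r"
    using binomial_le_power[of "card P" r] by (metis of_nat_le_iff of_nat_power)
  finally show "real (card ?W) \<le> real (card P) ^ r" .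
qed

text \<open>The condition on \<open>t\<close> limits the points lost by
  \<open>card_subsets_in_cells\<close> to \<open>k / 2\<close>, so a \<open>k\<close>-rich member
  contains at least \<open>k / 2\<close> of the \<open>r\<close>-subsets lying in one subcube. The
  right-hand side bounds the number of all such subsets, cell by cell.\<close>

lemma card_rich_le_subcubes:
  assumes "pseudolines A a r \<V>" and "r \<ge> 1" and "t \<ge> 1" and "k \<ge> 1"
    and "2 * real r * A * real t \<le> real k"
  shows "finite {V \<in> \<V>. rich P k V}"
    and "real (card {V \<in> \<V>. rich P k V}) * (real k / 2) \<le>
      real t ^ CARD('n) * (B * (a / t + 1) ^ CARD('n)) ^ r"
proof -
  let ?W = "{V \<in> \<V>. rich P k V}"
  let ?G = "\<lambda>S. {X. X \<subseteq> P \<inter> S \<and> card X = r}"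
  let ?F = "\<Union>S\<in>subcubes a t. ?G S"
  have fin: "finite ?F"
    by (rule finite_subset[of _ "Pow P"]) (use homogeneous_finite in auto)
  have ge: "real k / 2 \<le> real (card {X \<in> ?F. X \<subseteq> V})" if V: "V \<in> ?W" for V
  proof -
    let ?\<S> = "{S \<in> subcubes a t. V \<inter> S \<noteq> {}}"
    let ?H = "{X. X \<subseteq> P \<inter> V \<and> card X = r \<and> (\<exists>S\<in>?\<S>. X \<subseteq> S)}"
    have "card (P \<inter> V) \<le> card ?H + (r - 1) * card ?\<S>"
      using finite_subcubes[of a t] homogeneous_finite covered_by_met_subcubes[OF assms(3), of V]
      by (intro card_subsets_in_cells assms(2)) auto
    moreover have "card ?H \<le> card {X \<in> ?F. X \<subseteq> V}"
      by (intro card_mono finite_subset[OF _ fin]) blast+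
    moreover have "k \<le> card (P \<inter> V)" using V by (simp add: rich_def)
    ultimately have "k \<le> card {X \<in> ?F. X \<subseteq> V} + (r - 1) * card ?\<S>" by linarith
    then have "real k \<le> real (card {X \<in> ?F. X \<subseteq> V}) + real (r - 1) * real (card ?\<S>)"
      unfolding of_nat_mult[symmetric] of_nat_add[symmetric] by (rule of_nat_mono)
    moreover have "real (r - 1) * real (card ?\<S>) \<le> real r * (A * t)"
    proof (rule mult_mono)
      show "real (card ?\<S>) \<le> A * t"
        using card_met_subcubes_le[of A a \<V>] assms(1,3) V by (simp add: pseudolines_def)
    qed auto
    \<comment> \<open>The loss is at most \<open>r * A * t\<close>, which is half of the bound in
      the hypothesis on \<open>t\<close>.\<close>
    ultimately show ?thesis using assms(5) by linarith
  qed
  have uniq: "V = V'"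
    if "X \<in> ?F" "V \<in> ?W" "V' \<in> ?W" "X \<subseteq> V" "X \<subseteq> V'" for X V V'
    using of_type_uniq[of r \<V> X V V'] assms(1) that finite_subset[OF _ homogeneous_finite, of X]
    unfolding pseudolines_def by blast
  have k: "real k / 2 > 0" using assms(4) by simp
  note dc = double_count[OF fin k ge uniq, of ?W]
  show "finite ?W" by (rule dc(1)) auto
  have "real (card ?W) * (real k / 2) \<le> real (card ?F)"
    by (rule dc(2)) auto
  also have "\<dots> \<le> (\<Sum>S\<in>subcubes a t. real (card (?G S)))"
    unfolding of_nat_sum[symmetric] by (intro of_nat_mono card_UN_le finite_subcubes)
  also have "\<dots> \<le> real (card (subcubes a t :: (real ^ 'n) set set)) *
      (B * (a / t + 1) ^ CARD('n)) ^ r"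
  proof (rule sum_bounded_above)
    fix S :: "(real ^ 'n) set" assume S: "S \<in> subcubes a t"
    have "card (?G S) = (card (P \<inter> S) choose r)"
      using homogeneous_finite by (intro n_subsets) auto
    then have "real (card (?G S)) \<le> real (card (P \<inter> S)) ^ r"
      using binomial_le_power[of "card (P \<inter> S)" r] by (metis of_nat_le_iff of_nat_power)
    also have "\<dots> \<le> (B * (a / t + 1) ^ CARD('n)) ^ r"
      using card_subcube_le[OF S assms(3)] by (intro power_mono) auto
    finally show "real (card (?G S)) \<le> (B * (a / t + 1) ^ CARD('n)) ^ r" .
  qed
  also have "\<dots> \<le> real t ^ CARD('n) * (B * (a / t + 1) ^ CARD('n)) ^ r"
    using card_subcubes[of a t, where 'n = 'n] pos homogeneous_side_pos
    by (intro mult_right_mono) (auto simp flip: of_nat_power)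
  finally show "real (card ?W) * (real k / 2) \<le>
      real t ^ CARD('n) * (B * (a / t + 1) ^ CARD('n)) ^ r" .
qed

end

section \<open>Choice of the subdivision and the final bounds\<close>

lemma card_rich_bound:
  fixes r :: nat and c1 c2 B A C :: real
  assumes "r \<ge> 1" and "c1 > 0" and "c2 > 0" and "B > 0" and "A > 0" and "C > 0"
  shows "\<exists>K>0. \<forall>a (P :: (real ^ 'n) set) \<V> k.
       homogeneous c1 c2 B a P \<and> pseudolines A a r \<V> \<and> k \<ge> 1 \<and> k \<ge> r \<and>
       real k \<le> C * real (card P) powr (1 / real CARD('n))
       \<longrightarrow> finite {V \<in> \<V>. rich P k V} \<and>
           real (card {V \<in> \<V>. rich P k V})
             \<le> K * (real (card P) ^ r / real k ^ (CARD('n) * (r - 1) + 1))"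
proof -
  define n where "n = CARD('n)"
  define g1 where "g1 = c1 powr (1 / real n)"
  define g2 where "g2 = c2 powr (1 / real n)"
  \<comment> \<open>\<open>M * t \<le> k\<close> is the condition of
    \<open>card_rich_le_subcubes\<close>. \<open>E\<close> is chosen so that
    \<open>a / t + 1 \<le> E * \<nu> / k\<close>; \<open>K1\<close> serves \<open>k \<ge> M\<close>
    and \<open>K2\<close> serves \<open>k < M\<close>.\<close>
  define M where "M = 2 * real r * A"
  define E where "E = (1 + C / (M * g1)) * (2 * M * g2)"
  define K1 where "K1 = 2 * B ^ r * E ^ (n * r) / M ^ n"
  define K2 where "K2 = M ^ (n * (r - 1) + 1)"
  have pos: "g1 > 0" "g2 > 0" "M > 0"
    using assms by (auto simp: g1_def g2_def M_def)
  then have E: "E > 0" using assms by (auto simp: E_def intro!: mult_pos_pos add_pos_pos)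
  have K: "K1 > 0" "K2 > 0" using pos E assms by (auto simp: K1_def K2_def)
  show ?thesis
  proof (intro exI[of _ "K1 + K2"] conjI allI impI; (elim conjE)?)
    show "K1 + K2 > 0" using K by simp
  next
    fix a and P :: "(real ^ 'n) set" and \<V> :: "(real ^ 'n) set set" and k
    assume "homogeneous c1 c2 B a P" and ps: "pseudolines A a r \<V>" and "k \<ge> r"
    note card_rich_le_power(1)[OF this(1) assms(2-4) _ this(3)]
    with ps show "finite {V \<in> \<V>. rich P k V}" by (auto simp: pseudolines_def)
  next
    fix a and P :: "(real ^ 'n) set" and \<V> :: "(real ^ 'n) set set" and k
    assume hom: "homogeneous c1 c2 B a P" and ps: "pseudolines A a r \<V>" and k: "k \<ge> 1" "k \<ge> r"
      and kC: "real k \<le> C * real (card P) powr (1 / real CARD('n))"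
    let ?w = "real (card {V \<in> \<V>. rich P k V})"
    let ?N = "real (card P)"
    define \<nu> where "\<nu> = ?N powr (1 / real n)"
    have nu: "\<nu> \<ge> 1" "\<nu> ^ n = ?N" "g1 * \<nu> \<le> a" "a \<le> g2 * \<nu>"
      using homogeneous_side_bounds[OF hom assms(2-4)] by (simp_all add: \<nu>_def n_def g1_def g2_def)
    have a: "a > 0" using hom by (simp add: homogeneous_def)
    let ?e = "n * (r - 1) + 1"
    have "?w \<le> K1 * (?N ^ r / real k ^ ?e) \<or> ?w \<le> K2 * (?N ^ r / real k ^ ?e)"
    proof (cases "real k < M")
      \<comment> \<open>No \<open>t \<ge> 1\<close> is admissible here, but the power of
        \<open>k\<close> in the denominator is bounded by the constant \<open>K2\<close>, so the
        crude bound suffices.\<close>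
      case True
      have "?w \<le> ?N ^ r"
        using card_rich_le_power(2)[OF hom assms(2-4) _ k(2)] ps by (auto simp: pseudolines_def)
      also have "\<dots> \<le> K2 * (?N ^ r / real k ^ ?e)"
      proof -
        have "real k ^ ?e \<le> K2" unfolding K2_def using True by (intro power_mono) auto
        then have "?N ^ r * real k ^ ?e \<le> ?N ^ r * K2" by (intro mult_left_mono) auto
        then show ?thesis using k by (simp add: pos_le_divide_eq mult.commute)
      qed
      finally show ?thesis by blast
    next
      case False
      \<comment> \<open>The largest admissible \<open>t\<close>. As it is at least 1, rounding down
        loses at most a factor 2.\<close>
      define t where "t = nat \<lfloor>real k / M\<rfloor>"
      have kM: "real k / M \<ge> 1" using False pos by simp
      have "t \<ge> 1" "real t \<le> real k / M" "real k / M \<le> real t + 1"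
        using kM unfolding t_def by linarith+
      then have t: "t \<ge> 1" "real t \<le> real k / M" "real k / M \<le> 2 * real t"
        by linarith+
      have tk: "M * real t \<le> real k" "real k \<le> 2 * M * real t"
        using t pos by (auto simp: field_simps)
      have k0: "real k > 0" using k by simp
      \<comment> \<open>The upper bound on \<open>k\<close> enters here: it keeps the side
        \<open>a / t\<close> bounded below, so that the 1 in \<open>a / t + 1\<close> is at most a
        constant times \<open>a / t\<close>.\<close>
      have "M * real t \<le> C * \<nu>" using kC tk by (simp add: \<nu>_def n_def)
      also have "\<nu> \<le> a / g1" using nu pos by (simp add: field_simps)
      finally have "M * real t \<le> C * (a / g1)" using assms(6) by simp
      then have "1 \<le> C / (M * g1) * (a / t)"
        using pos t by (simp add: field_simps)
      then have "a / t + 1 \<le> (1 + C / (M * g1)) * (a / t)" by (simp add: algebra_simps)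
      also have "\<dots> \<le> (1 + C / (M * g1)) * (2 * M * g2 * \<nu> / real k)"
      proof (rule mult_left_mono)
        have "a * real k \<le> (g2 * \<nu>) * (2 * M * real t)"
          using nu tk pos a by (intro mult_mono) auto
        then show "a / t \<le> 2 * M * g2 * \<nu> / real k"
          using t k0 by (simp add: field_simps)
        show "0 \<le> 1 + C / (M * g1)" using pos assms(6) by simp
      qed
      also have "\<dots> = E * \<nu> / real k" by (simp add: E_def)
      finally have side: "a / t + 1 \<le> E * \<nu> / real k" .
      have "?w * (real k / 2) \<le> real t ^ n * (B * (a / t + 1) ^ n) ^ r"
        using card_rich_le_subcubes(2)[OF hom assms(2-4) ps assms(1) t(1) k(1)] tk
        by (simp add: M_def n_def)
      also have "\<dots> \<le> (real k / M) ^ n * (B * (E * \<nu> / real k) ^ n) ^ r"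
        using t side a assms(4) pos
        by (intro mult_mono power_mono mult_left_mono) auto
      also have "\<dots> = B ^ r * E ^ (n * r) / M ^ n * (?N ^ r * real k ^ n / real k ^ (n * r))"
        using nu(2) by (simp add: power_mult_distrib power_divide power_mult)
      \<comment> \<open>Cancelling \<open>k ^ n\<close> leaves the exponent
        \<open>n * (r - 1)\<close>; dividing by \<open>k / 2\<close> afterwards supplies the
        remaining \<open>+ 1\<close>.\<close>
      also have "real k ^ (n * r) = real k ^ n * real k ^ (n * (r - 1))"
      proof -
        have "n * r = n + n * (r - 1)" using assms(1) by (cases r) auto
        then show ?thesis by (metis power_add)
      qed
      finally have "?w * (real k / 2) \<le> B ^ r * E ^ (n * r) / M ^ n * (?N ^ r / real k ^ (n * (r - 1)))"
        using k0 by simp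
      then have "?w \<le> (B ^ r * E ^ (n * r) / M ^ n * (?N ^ r / real k ^ (n * (r - 1)))) * 2 / real k"
        using k0 by (subst pos_le_divide_eq) simp_all
      also have "\<dots> = K1 * (?N ^ r / real k ^ ?e)"
        by (simp add: K1_def mult_ac)
      finally show ?thesis by blast
    qed
    moreover have "?N ^ r / real k ^ ?e \<ge> 0" by simp
    ultimately show "?w \<le> (K1 + K2) * (?N ^ r / real k ^ (CARD('n) * (r - 1) + 1))"
      using K mult_nonneg_nonneg[of K1 "?N ^ r / real k ^ ?e"] mult_nonneg_nonneg[of K2 "?N ^ r / real k ^ ?e"]
      unfolding n_def[symmetric] distrib_right by linarith
  qed
qed

text \<open>All constants precede \<open>a\<close>, \<open>P\<close>, the family and
  \<open>k\<close>, so they depend only on the dimension, \<open>r\<close> and the implied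
  constants; \<open>K\<close> may also depend on \<open>C\<close>. Finiteness is asserted separately
  because \<open>card\<close> of an infinite set is 0.\<close>

theorem theorem1p3:
  fixes r :: nat and c1 c2 B A :: real
  assumes "r \<ge> 1" and "c1 > 0" and "c2 > 0" and "B > 0" and "A > 0"
  shows "\<exists>C0>0. \<forall>C\<ge>C0.
    (\<forall>a (P :: (real ^ 'n) set) \<V> k.
       homogeneous c1 c2 B a P \<and> pseudolines A a r \<V> \<and> k \<ge> 1 \<and>
       real k \<ge> C * real (card P) powr (1 / real CARD('n))
       \<longrightarrow> \<not> (\<exists>V\<in>\<V>. rich P k V)) \<and>
    (\<exists>K>0. \<forall>a (P :: (real ^ 'n) set) \<V> k.
       homogeneous c1 c2 B a P \<and> pseudolines A a r \<V> \<and> k \<ge> 1 \<and> k \<ge> r \<and>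
       real k \<le> C * real (card P) powr (1 / real CARD('n))
       \<longrightarrow> finite {V \<in> \<V>. rich P k V} \<and>
           real (card {V \<in> \<V>. rich P k V})
             \<le> K * (real (card P) ^ r / real k ^ (CARD('n) * (r - 1) + 1)))"
proof -
  define C1 where "C1 = A * B * 2 ^ CARD('n) * (c2 powr (1 / real CARD('n)) + 1)"
  have C1: "C1 > 0"
    unfolding C1_def using assms by (intro mult_pos_pos add_nonneg_pos) auto
  have "\<not> (\<exists>V\<in>\<V>. rich P k V)"
    if C: "C \<ge> C1 + 1" and hom: "homogeneous c1 c2 B a P" and ps: "pseudolines A a r \<V>"
      and k: "real k \<ge> C * real (card P) powr (1 / real CARD('n))"
    for C a k and P :: "(real ^ 'n) set" and \<V>
  proof
    let ?\<nu> = "real (card P) powr (1 / real CARD('n))"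
    assume "\<exists>V\<in>\<V>. rich P k V"
    then obtain V where V: "V \<in> \<V>" "rich P k V" by blast
    have nu: "?\<nu> \<ge> 1" by (rule homogeneous_side_bounds(1)[OF hom assms(2-4)])
    have "real k \<le> real (card (P \<inter> V))" using V by (simp add: rich_def)
    also have "\<dots> \<le> C1 * ?\<nu>"
      using card_pseudoline_le[OF hom assms(2-4) _ assms(5) V(1)] ps
      by (simp add: C1_def pseudolines_def)
    \<comment> \<open>The threshold \<open>C1 + 1\<close> makes this strict, which also excludes
      equality in the lower bound on \<open>k\<close>.\<close>
    also have "\<dots> < C * ?\<nu>" by (rule mult_strict_right_mono) (use C nu in linarith)+
    finally show False using k by simp
  qed
  note no_rich = this
  show ?thesis
  proof (rule exI[of _ "C1 + 1"], intro conjI allI impI, goal_cases)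
    case 1
    then show ?case using C1 by simp
  next
    case (2 C a P \<V> k)
    then show ?case by (intro no_rich) auto
  next
    case (3 C)
    then show ?case using C1 by (intro card_rich_bound[OF assms]) simp
  qed
qed

end
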